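(* Let $R$ be a reduced commutative ring, let $n\in\mathbb{N}$, and let $A$ be a $1$-principled $n\times n$-matrix over $R$. Then $A$ is $1$-nullcyclic. Consequently, every power $A^m$ (with $m\in\mathbb{Z}$) of $A$ is $1$-principled.
   Context: All rings are commutative, associative and unital; $\mathbb{N}=\{0,1,2,\ldots\}$ and $[n]:=\{1,2,\ldots,n\}$. Let $A=(a_{i,j})_{i,j\in[n]}$ be a matrix over $R$. For $S\subseteq[n]$, $A_S$ denotes the principal submatrix of $A$ with row and column set $S$; the empty determinant is $1$. $A$ is $1$-principled if $\det A_S=1$ for every $S\subseteq[n]$. (Such a matrix has determinant $1$, hence is invertible, so $A^m$ is defined for every integer $m$.) A cycle on $[n]$ is a $k$-tuple $C=(i_1,i_2,\ldots,i_k)$ with $k>0$ and $i_1,\ldots,i_k$ distinct elements of $[n]$, considered up to cyclic rotation; it is nontrivial if $k>1$. The $A$-weight of a cycle $C=(i_1,\ldots,i_k)$ is $w_A(C):=a_{i_1,i_2}a_{i_2,i_3}\cdots a_{i_{k-1},i_k}a_{i_k,i_1}$. $A$ is nullcyclic if $w_A(C)=0$ for each nontrivial cycle $C$ on $[n]$; it is $1$-diagonal if all its diagonal entries equal $1$; it is $1$-nullcyclic if it is both $1$-diagonal and nullcyclic. *)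

theory Defs
  imports
    "Jordan_Normal_Form.Determinant"
    "Jordan_Normal_Form.DL_Submatrix"
begin

text \<open>Rows and columns are indexed by \<open>{..<n}\<close> instead of \<open>{1, \<dots>, n}\<close>; \<open>n = 0\<close> is allowed.\<close>

definition reduced_ring :: "'a::comm_ring_1 itself \<Rightarrow> bool" where
  "reduced_ring _ \<longleftrightarrow> (\<forall>(x::'a) (k::nat). x ^ k = 0 \<longrightarrow> x = 0)"

text \<open>The case \<open>S = {}\<close> is the determinant of the \<open>0 \<times> 0\<close> matrix, which is \<open>1\<close>.\<close>

definition one_principled :: "nat \<Rightarrow> 'a::comm_ring_1 mat \<Rightarrow> bool" where
  "one_principled n A \<longleftrightarrow>
     A \<in> carrier_mat n n \<and> (\<forall>S \<subseteq> {..<n}. det (submatrix A S S) = 1)"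

text \<open>A cycle is represented by any of its tuples; by \<open>cycle_weight_rotate\<close> below, the weight
  does not depend on the choice of the representative up to rotation.\<close>

definition is_cycle :: "nat \<Rightarrow> nat list \<Rightarrow> bool" where
  "is_cycle n C \<longleftrightarrow> C \<noteq> [] \<and> distinct C \<and> set C \<subseteq> {..<n}"

definition nontrivial_cycle :: "nat \<Rightarrow> nat list \<Rightarrow> bool" where
  "nontrivial_cycle n C \<longleftrightarrow> is_cycle n C \<and> length C > 1"

definition cycle_weight :: "'a::comm_ring_1 mat \<Rightarrow> nat list \<Rightarrow> 'a" where
  "cycle_weight A C = (\<Prod>k<length C. A $$ (C ! k, C ! (Suc k mod length C)))"

definition nullcyclic :: "nat \<Rightarrow> 'a::comm_ring_1 mat \<Rightarrow> bool" where
  "nullcyclic n A \<longleftrightarrow>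
     A \<in> carrier_mat n n \<and> (\<forall>C. nontrivial_cycle n C \<longrightarrow> cycle_weight A C = 0)"

definition one_diagonal :: "nat \<Rightarrow> 'a::comm_ring_1 mat \<Rightarrow> bool" where
  "one_diagonal n A \<longleftrightarrow> A \<in> carrier_mat n n \<and> (\<forall>i<n. A $$ (i, i) = 1)"

definition one_nullcyclic :: "nat \<Rightarrow> 'a::comm_ring_1 mat \<Rightarrow> bool" where
  "one_nullcyclic n A \<longleftrightarrow> one_diagonal n A \<and> nullcyclic n A"

text \<open>Integer powers are those of the matrix ring: \<open>A ^ m\<close> for \<open>m < 0\<close> is the inverse of
  \<open>A ^ (-m)\<close> in \<open>ring_mat\<close>, hence meaningful only for units; see \<open>one_principled_unit\<close>.\<close>

definition mat_int_pow :: "nat \<Rightarrow> 'a::comm_ring_1 mat \<Rightarrow> int \<Rightarrow> 'a mat" where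
  "mat_int_pow n A m = A [^]\<^bsub>ring_mat TYPE('a) n ()\<^esub> m"

lemma cycle_weight_rotate1: "cycle_weight A (rotate1 C) = cycle_weight A C"
proof (cases "C = []")
  case False
  define l where "l = length C"
  have l: "l > 0" using False by (simp add: l_def)
  have "cycle_weight A (rotate1 C) =
      (\<Prod>k<l. A $$ (C ! (Suc k mod l), C ! (Suc (Suc k mod l) mod l)))"
    unfolding cycle_weight_def using l by (auto intro!: prod.cong simp: nth_rotate1 l_def)
  also have "\<dots> = (\<Prod>k<l. A $$ (C ! k, C ! (Suc k mod l)))"
  proof (rule prod.reindex_bij_betw[where h = "\<lambda>k. Suc k mod l"])
    have "inj_on (\<lambda>k. Suc k mod l) {..<l}"
      by (auto simp: inj_on_def mod_Suc split: if_splits)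
    moreover have "(\<lambda>k. Suc k mod l) ` {..<l} \<subseteq> {..<l}" using l by auto
    ultimately show "bij_betw (\<lambda>k. Suc k mod l) {..<l} {..<l}"
      by (simp add: bij_betw_def endo_inj_surj)
  qed
  finally show ?thesis by (simp add: cycle_weight_def l_def)
qed simp

lemma cycle_weight_rotate: "cycle_weight A (rotate k C) = cycle_weight A C"
  by (induction k) (simp_all add: cycle_weight_rotate1)

lemma one_principled_unit:
  fixes A :: "'a::comm_ring_1 mat"
  assumes "one_principled n A"
  shows "A \<in> Units (ring_mat TYPE('a) n b)"
proof -
  have A: "A \<in> carrier_mat n n" using assms by (simp add: one_principled_def)
  have pick: "pick {..<n} i = i" if "i < n" for i
  proof -
    have "{a \<in> {..<n}. a < i} = {..<i}" using that by auto
    then show ?thesis using pick_card_in_set[of i "{..<n}"] that by simp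
  qed
  have "{i. i < n \<and> i \<in> {..<n}} = {..<n}" by auto
  then have "submatrix A {..<n} {..<n} = A"
    using A by (intro eq_matI) (auto simp: submatrix_def pick)
  then have d: "det A = 1" using assms by (auto simp: one_principled_def)
  have "1 \<cdot>\<^sub>m 1\<^sub>m n = (1\<^sub>m n :: 'a mat)" by (intro eq_matI) auto
  then show ?thesis using adj_mat[OF A] A d unfolding Units_def ring_mat_def by auto
qed

end

theory Submission
  imports Defs "HOL-Combinatorics.Cycles"
begin

text \<open>
  Read a matrix as a weighted digraph on its indices.  If the ring were a domain, the edges of
  nonzero weight would form a digraph, and a shortest nontrivial cycle \<open>C\<close> in it would have no
  chord, so that the determinant on the vertices of \<open>C\<close> would consist of just two Leibniz terms:
  \<open>1\<close> for the identity and \<open>\<plusminus> w(C)\<close> for \<open>C\<close> itself.  A principal minor equal to \<open>1\<close> would then force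
  \<open>w(C) = 0\<close>.  Over a reduced ring the same argument runs without passing to residue domains:
  by induction on the length of \<open>C\<close>, multiply the Leibniz expansion by \<open>w(C)\<close>.  Every permutation of
  the vertices other than the identity and \<open>C\<close> uses a chord of \<open>C\<close>, and \<open>w(C)\<close> times the weight of
  a chord is a multiple of the weight of a shorter cycle, hence \<open>0\<close>
  (\<open>cycle_weight_mult_chord\<close>, \<open>permutation_on_cycle_cases\<close>).  What is left is
  \<open>w(C) = w(C) \<plusminus> w(C)\<^sup>2\<close>, so \<open>w(C)\<close> is nilpotent (\<open>one_principled_imp_one_nullcyclic\<close>).

  Conversely, a permutation other than the identity contains a nontrivial cycle, so every principal
  minor of a 1-nullcyclic matrix is \<open>1\<close> (\<open>one_nullcyclic_imp_one_principled\<close>).  It therefore suffices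
  that powers of a 1-nullcyclic matrix \<open>A\<close> are 1-nullcyclic.  In the domain case this holds because
  \<open>A\<close> is unitriangular for some order of the indices.  In general, that order is replaced by
  a family of ideals: \<open>path_closure n A i j\<close> contains the weights of all paths from \<open>i\<close> to \<open>j\<close>.
  These ideals multiply along concatenation of paths, and since nontrivial closed
  walks without loops have weight \<open>0\<close>, the ideal for \<open>(i, j)\<close> annihilates the one for \<open>(j, i)\<close>
  when \<open>i \<noteq> j\<close>.  So the matrices with diagonal entries \<open>1\<close> and other entries in these ideals are
  1-nullcyclic (\<open>path_unipotent_imp_one_nullcyclic\<close>) and closed under products
  (\<open>path_unipotent_mult\<close>), and the inverse of \<open>A\<close> is one of them
  (\<open>path_unipotent_right_inverse\<close>).
\<close>

section \<open>Walks in the digraph of a matrix\<close>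

fun walk_weight :: "'a::comm_ring_1 mat \<Rightarrow> nat list \<Rightarrow> 'a" where
  "walk_weight A (x # y # zs) = A $$ (x, y) * walk_weight A (y # zs)"
| "walk_weight A zs = 1"

lemma walk_weight_append:
  "walk_weight A (xs @ y # ys) = walk_weight A (xs @ [y]) * walk_weight A (y # ys)"
proof (induction xs)
  case (Cons x xs)
  then show ?case by (cases xs) (simp_all add: mult.assoc)
qed simp

lemma walk_weight_snoc:
  "xs \<noteq> [] \<Longrightarrow> walk_weight A (xs @ [y]) = walk_weight A xs * A $$ (last xs, y)"
  by (induction xs rule: induct_list012) (simp_all add: mult.assoc)

lemma walk_weight_nth: "walk_weight A xs = (\<Prod>k<length xs - 1. A $$ (xs ! k, xs ! Suc k))"
proof (induction A xs rule: walk_weight.induct)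
  case (1 A x y zs)
  then show ?case by (simp add: prod.lessThan_Suc_shift del: prod.lessThan_Suc)
qed simp_all

lemma cycle_weight_eq_walk_weight:
  assumes "C \<noteq> []"
  shows "cycle_weight A C = walk_weight A (C @ [hd C])"
  unfolding cycle_weight_def walk_weight_nth
proof (rule prod.cong)
  fix k assume "k \<in> {..<length (C @ [hd C]) - 1}"
  then have "k < length C" by simp
  moreover have "C ! (Suc k mod length C) = (C @ [hd C]) ! Suc k"
  proof (cases "Suc k = length C")
    case True
    then show ?thesis using assms by (simp add: nth_append hd_conv_nth)
  next
    case False
    with \<open>k < length C\<close> have "Suc k < length C" by simp
    then show ?thesis by (simp add: nth_append)
  qed
  ultimately show "A $$ (C ! k, C ! (Suc k mod length C)) =
      A $$ ((C @ [hd C]) ! k, (C @ [hd C]) ! Suc k)"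
    by (simp add: nth_append)
qed simp

lemma distinct_imp_successively_neq: "distinct xs \<Longrightarrow> successively (\<noteq>) xs"
  by (simp add: successively_conv_nth nth_eq_iff_index_eq)

text \<open>A walk that repeats a vertex contains a closed walk between two visits; without loops,
  an innermost such closed walk is a nontrivial cycle, and its weight is a factor.\<close>

lemma nullcyclic_walk_weight_eq_0:
  assumes "nullcyclic n A" "set xs \<subseteq> {..<n}" "successively (\<noteq>) xs" "\<not> distinct xs"
  shows "walk_weight A xs = 0"
  using assms(2-4)
proof (induction "length xs" arbitrary: xs rule: less_induct)
  case less
  obtain us y vs ws where xs: "xs = us @ [y] @ vs @ [y] @ ws"
    using not_distinct_decomp[OF less.prems(3)] by blast
  have "walk_weight A xs = walk_weight A (us @ [y]) * walk_weight A ((y # vs) @ y # ws)"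
    using walk_weight_append[of A us y "vs @ y # ws"] xs by simp
  also have "walk_weight A ((y # vs) @ y # ws)
      = walk_weight A (y # vs @ [y]) * walk_weight A (y # ws)"
    using walk_weight_append[of A "y # vs" y ws] by simp
  also have "walk_weight A (y # vs @ [y]) = 0"
  proof (cases "distinct (y # vs)")
    case True
    have "vs \<noteq> []" using less.prems(2) xs by (auto simp: successively_append_iff)
    then have "nontrivial_cycle n (y # vs)"
      using True less.prems(1) xs by (auto simp: nontrivial_cycle_def is_cycle_def)
    then have "cycle_weight A (y # vs) = 0" using assms(1) by (auto simp: nullcyclic_def)
    then show ?thesis by (simp add: cycle_weight_eq_walk_weight)
  next
    case False
    have "successively (\<noteq>) (y # vs)"
      using less.prems(2) successively_append_iff[of "(\<noteq>)" us "(y # vs) @ y # ws"]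
        successively_append_iff[of "(\<noteq>)" "y # vs" "y # ws"] xs by simp
    then have "walk_weight A (y # vs) = 0"
      using less.hyps[of "y # vs"] less.prems(1) xs False by auto
    then show ?thesis using walk_weight_snoc[of "y # vs" A y] by simp
  qed
  finally show ?case by simp
qed

section \<open>Principal minors as sums over permutations\<close>

text \<open>The Leibniz formula, transported along the increasing enumeration \<open>pick S\<close> of the index
  set; conjugation by a bijection preserves signs.\<close>

lemma det_submatrix_eq_sum:
  fixes A :: "'a::comm_ring_1 mat"
  assumes A: "A \<in> carrier_mat n n" and S: "S \<subseteq> {..<n}"
  shows "det (submatrix A S S) = (\<Sum>p | p permutes S. signof p * (\<Prod>i\<in>S. A $$ (i, p i)))"
proof -
  define m where "m = card S"
  define f where "f = pick S"
  have fin: "finite S" using S by (rule finite_subset) simp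
  have S': "{i. i < n \<and> i \<in> S} = S" using S by auto
  have inj: "inj_on f {0..<m}"
    by (rule linorder_inj_onI')
       (use pick_mono_le[of _ S] in \<open>fastforce simp: f_def m_def\<close>)
  have "f ` {0..<m} \<subseteq> S" by (auto simp: f_def m_def pick_in_set_le)
  moreover have "card (f ` {0..<m}) = card S" using card_image[OF inj] by (simp add: m_def)
  ultimately have img: "f ` {0..<m} = S" using fin by (intro card_subset_eq)
  have bij: "bij_betw f {0..<m} S" using inj img by (simp add: bij_betw_def)
  have M: "submatrix A S S \<in> carrier_mat m m"
    using A S' by (auto simp: submatrix_def m_def)
  have idx: "submatrix A S S $$ (i, j) = A $$ (f i, f j)" if "i < m" "j < m" for i j
    using that A S' by (simp add: submatrix_def m_def f_def)
  define F where "F = map_permutation {0..<m} f"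
  have bijF: "bij_betw F {p. p permutes {0..<m}} {p. p permutes S}"
  proof (rule bij_betw_byWitness[where f' = "map_permutation S (inv_into {0..<m} f)"])
    show "\<forall>p\<in>{p. p permutes {0..<m}}. map_permutation S (inv_into {0..<m} f) (F p) = p"
      unfolding F_def using bij inj by (auto intro!: map_permutation_compose_inv)
    show "\<forall>p\<in>{p. p permutes S}. F (map_permutation S (inv_into {0..<m} f) p) = p"
      unfolding F_def mem_Collect_eq
      by (intro ballI, rule map_permutation_compose_inv[OF bij_betw_inv_into[OF bij]])
         (simp_all add: f_inv_into_f img)
    show "F ` {p. p permutes {0..<m}} \<subseteq> {p. p permutes S}"
      unfolding F_def using bij by (auto intro: map_permutation_permutes)
    show "map_permutation S (inv_into {0..<m} f) ` {p. p permutes S} \<subseteq> {p. p permutes {0..<m}}"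
      using bij by (auto intro: map_permutation_permutes bij_betw_inv_into)
  qed
  have "det (submatrix A S S) = (\<Sum>p | p permutes {0..<m}.
      signof p * (\<Prod>i = 0..<m. submatrix A S S $$ (i, p i)))"
    by (rule det_def'[OF M])
  also have "\<dots> = (\<Sum>p | p permutes {0..<m}. signof (F p) * (\<Prod>i\<in>S. A $$ (i, F p i)))"
  proof (rule sum.cong)
    fix p assume "p \<in> {p. p permutes {0..<m}}"
    then have p: "p permutes {0..<m}" by simp
    have "(\<Prod>i\<in>S. A $$ (i, F p i)) = (\<Prod>i = 0..<m. A $$ (f i, F p (f i)))"
      using prod.reindex_bij_betw[OF bij, of "\<lambda>i. A $$ (i, F p i)"] by simp
    also have "\<dots> = (\<Prod>i = 0..<m. submatrix A S S $$ (i, p i))"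
    proof (rule prod.cong)
      fix i assume i: "i \<in> {0..<m}"
      then have "p i < m" using permutes_in_image[OF p, of i] by simp
      then show "A $$ (f i, F p (f i)) = submatrix A S S $$ (i, p i)"
        using i map_permutation_apply[OF inj i, of p] by (simp add: idx F_def)
    qed simp
    finally show "signof p * (\<Prod>i = 0..<m. submatrix A S S $$ (i, p i)) =
        signof (F p) * (\<Prod>i\<in>S. A $$ (i, F p i))"
      using sign_map_permutation[OF inj p] by (simp add: F_def)
  qed simp
  also have "\<dots> = (\<Sum>p | p permutes S. signof p * (\<Prod>i\<in>S. A $$ (i, p i)))"
    by (rule sum.reindex_bij_betw[OF bijF])
  finally show ?thesis .
qed

section \<open>1-principled matrices over reduced rings are 1-nullcyclic\<close>

lemma map_cycle_of_list_rotate: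
  assumes "distinct C"
  shows "map (cycle_of_list C) (rotate k C) = rotate1 (rotate k C)"
proof -
  have "map (cycle_of_list C) C = rotate1 C" using cyclic_rotation[OF assms, of 1] by simp
  then show ?thesis by (simp only: rotate_map[symmetric] rotate1_rotate_swap[symmetric])
qed

lemma cycle_weight_eq_prod_cycle_of_list:
  assumes "distinct C"
  shows "cycle_weight A C = (\<Prod>i\<in>set C. A $$ (i, cycle_of_list C i))"
proof -
  have "map (cycle_of_list C) C = rotate1 C" using map_cycle_of_list_rotate[OF assms, of 0] by simp
  then have "cycle_of_list C (C ! k) = C ! (Suc k mod length C)" if "k < length C" for k
    using that by (metis nth_map nth_rotate1)
  then have "cycle_weight A C = (\<Prod>k<length C. A $$ (C ! k, cycle_of_list C (C ! k)))"
    unfolding cycle_weight_def by (auto intro: prod.cong)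
  also have "\<dots> = (\<Prod>i\<in>set C. A $$ (i, cycle_of_list C i))"
    by (rule prod.reindex_bij_betw[OF bij_betw_nth]) (use assms in auto)
  finally show ?thesis .
qed

text \<open>A chord from \<open>v\<close> to \<open>u\<close> closes the arc of \<open>C\<close> from \<open>u\<close> to \<open>v\<close> to a cycle \<open>D\<close>.  Since \<open>u\<close> is
  not the successor of \<open>v\<close>, this arc misses a vertex of \<open>C\<close>, so \<open>D\<close> is shorter than \<open>C\<close>.  The edges
  of the arc all occur in \<open>C\<close>, so the product below is a multiple of the weight of \<open>D\<close>.\<close>

lemma cycle_weight_mult_chord:
  assumes C: "nontrivial_cycle n C"
    and shorter: "\<And>D. nontrivial_cycle n D \<Longrightarrow> length D < length C \<Longrightarrow> cycle_weight A D = 0"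
    and v: "v \<in> set C" and u: "u \<in> set C" "u \<noteq> v" "u \<noteq> cycle_of_list C v"
  shows "cycle_weight A C * A $$ (v, u) = 0"
proof -
  have dist: "distinct C" and Cn: "set C \<subseteq> {..<n}"
    using C by (auto simp: nontrivial_cycle_def is_cycle_def)
  obtain as bs where C_eq: "C = as @ v # bs" using split_list[OF v] by blast
  (* C is rotated so that v comes last; its successor on C is then the head of E. *)
  define E where "E = bs @ as"
  have rot: "rotate (Suc (length as)) C = E @ [v]"
    using rotate_append[of "as @ [v]" bs] by (simp add: C_eq E_def)
  have wC: "cycle_weight A C = cycle_weight A (E @ [v])"
    using cycle_weight_rotate[of A "Suc (length as)" C] rot by simp
  have uE: "u \<in> set E" using u C_eq by (auto simp: E_def)
  have sucv: "cycle_of_list C v = hd E"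
  proof -
    have "map (cycle_of_list C) (E @ [v]) = rotate1 (E @ [v])"
      using map_cycle_of_list_rotate[OF dist, of "Suc (length as)"] by (simp only: rot)
    then have "last (map (cycle_of_list C) (E @ [v])) = last (rotate1 (E @ [v]))" by simp
    then show ?thesis using uE by (cases E) auto
  qed
  obtain ys zs where E_eq: "E = ys @ u # zs" using split_list[OF uE] by blast
  have ys: "ys \<noteq> []" using u(3) sucv E_eq by auto
  let ?D = "u # zs @ [v]"
  have dE: "distinct (E @ [v])" and lE: "length (E @ [v]) = length C" and sE: "set (E @ [v]) = set C"
    using dist by (auto simp: E_def C_eq)
  have "nontrivial_cycle n ?D"
    using dE sE Cn E_eq u(2) by (auto simp: nontrivial_cycle_def is_cycle_def)
  moreover have "length ?D < length C" using lE E_eq ys by (cases ys) auto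
  ultimately have "cycle_weight A ?D = 0" by (rule shorter)
  then have D0: "walk_weight A ?D * A $$ (v, u) = 0"
    using walk_weight_snoc[of ?D A u] by (simp add: cycle_weight_eq_walk_weight)
  have "cycle_weight A (E @ [v]) = walk_weight A (ys @ u # (zs @ [v, hd E]))"
    using E_eq by (simp add: cycle_weight_eq_walk_weight hd_append)
  also have "\<dots> = walk_weight A (ys @ [u]) * walk_weight A ((u # zs) @ v # [hd E])"
    by (subst walk_weight_append) simp
  also have "walk_weight A ((u # zs) @ v # [hd E]) = walk_weight A ?D * A $$ (v, hd E)"
    by (subst walk_weight_append) simp
  finally have "cycle_weight A C * A $$ (v, u)
      = walk_weight A (ys @ [u]) * A $$ (v, hd E) * (walk_weight A ?D * A $$ (v, u))"
    using wC by (simp add: mult_ac)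
  then show ?thesis using D0 by simp
qed

text \<open>If \<open>p\<close> moves \<open>i\<close> to its successor \<open>c i\<close> on the cycle, injectivity forbids \<open>p\<close> to fix \<open>c i\<close>, so
  \<open>p\<close> moves \<open>c i\<close> to its successor as well, and so on around the whole cycle.\<close>

lemma permutation_on_cycle_cases:
  assumes dist: "distinct C" and p: "p permutes set C"
    and step: "\<And>i. i \<in> set C \<Longrightarrow> p i = i \<or> p i = cycle_of_list C i"
  shows "p = id \<or> p = cycle_of_list C"
proof (cases "\<forall>i\<in>set C. p i = i")
  case True
  then have "p i = i" for i using permutes_not_in[OF p, of i] by (cases "i \<in> set C") auto
  then show ?thesis by auto
next
  case False
  let ?c = "cycle_of_list C"
  obtain i where i: "i \<in> set C" "p i \<noteq> i" using False by blast
  obtain as bs where C_eq: "C = as @ i # bs" using split_list[OF i(1)] by blast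
  define E where "E = i # bs @ as"
  have rot: "rotate (length as) C = E" using rotate_append[of as "i # bs"] by (simp add: C_eq E_def)
  have mapE: "map ?c E = rotate1 E"
    using map_cycle_of_list_rotate[OF dist, of "length as"] by (simp only: rot)
  have c: "?c (E ! k) = E ! Suc k" if "Suc k < length E" for k
  proof -
    have "map ?c E ! k = rotate1 E ! k" by (simp add: mapE)
    then show ?thesis using that by (simp add: nth_rotate1)
  qed
  have dE: "distinct E" and sE: "set E = set C" using dist by (auto simp: C_eq E_def)
  have moved: "p (E ! k) \<noteq> E ! k" if "k < length E" for k
    using that
  proof (induction k)
    case 0
    then show ?case using i by (simp add: E_def)
  next
    case (Suc k)
    then have "E ! k \<in> set C" "p (E ! k) \<noteq> E ! k" using sE nth_mem[of k E] by auto
    then have "p (E ! k) = E ! Suc k" using step[of "E ! k"] c[of k] Suc.prems by auto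
    moreover have "E ! k \<noteq> E ! Suc k" using dE Suc.prems by (simp add: nth_eq_iff_index_eq)
    ultimately show ?case using permutes_inj[OF p] by (metis injD)
  qed
  have "p j = ?c j" for j
  proof (cases "j \<in> set C")
    case True
    then obtain k where "k < length E" "j = E ! k" using sE by (metis in_set_conv_nth)
    then show ?thesis using moved step True by auto
  next
    case False
    then show ?thesis using permutes_not_in[OF p] id_outside_supp[of j C] by simp
  qed
  then show ?thesis by auto
qed

lemma one_principled_imp_one_diagonal:
  assumes "one_principled n A"
  shows "one_diagonal n A"
proof -
  have A: "A \<in> carrier_mat n n" using assms by (simp add: one_principled_def)
  have "A $$ (i, i) = 1" if "i < n" for i
  proof -
    have "det (submatrix A {i} {i}) = 1" using assms that by (simp add: one_principled_def)
    then show ?thesis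
      using det_submatrix_eq_sum[OF A, of "{i}"] that by simp
  qed
  then show ?thesis using A by (simp add: one_diagonal_def)
qed

lemma one_principled_imp_one_nullcyclic:
  fixes A :: "'a::comm_ring_1 mat"
  assumes red: "reduced_ring TYPE('a)" and princ: "one_principled n A"
  shows "one_nullcyclic n A"
proof -
  have A: "A \<in> carrier_mat n n" using princ by (simp add: one_principled_def)
  have diag: "A $$ (i, i) = 1" if "i < n" for i
    using one_principled_imp_one_diagonal[OF princ] that by (simp add: one_diagonal_def)
  have "cycle_weight A C = 0" if "nontrivial_cycle n C" for C
    using that
  proof (induction "length C" arbitrary: C rule: less_induct)
    case less
    have dist: "distinct C" and Cn: "set C \<subseteq> {..<n}" and len: "length C > 1"
      using less.prems by (auto simp: nontrivial_cycle_def is_cycle_def)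
    let ?c = "cycle_of_list C" and ?w = "cycle_weight A C"
    let ?t = "\<lambda>p. signof p * (\<Prod>i\<in>set C. A $$ (i, p i))"
    have c: "?c permutes set C" by (rule cycle_permutes)
    have cneq: "?c \<noteq> id"
    proof
      assume "?c = id"
      then have "rotate1 C = C" using cyclic_rotation[OF dist, of 1] by simp
      moreover have "rotate1 C ! 0 \<noteq> C ! 0"
        using len dist nth_rotate1[of 0 C] nth_eq_iff_index_eq[OF dist, of 1 0] by fastforce
      ultimately show False by simp
    qed
    have other: "?w * ?t p = 0" if p: "p permutes set C" and ne: "p \<noteq> id" "p \<noteq> ?c" for p
    proof -
      obtain i where i: "i \<in> set C" "p i \<noteq> i" "p i \<noteq> ?c i"
        using permutation_on_cycle_cases[OF dist p] ne by blast
      have "p i \<in> set C" using permutes_in_image[OF p] i by simp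
      then have "?w * A $$ (i, p i) = 0"
        using cycle_weight_mult_chord[OF less.prems _ i(1)] less.hyps i by blast
      moreover have "(\<Prod>i\<in>set C. A $$ (i, p i)) =
          A $$ (i, p i) * (\<Prod>i\<in>set C - {i}. A $$ (i, p i))"
        using i(1) by (simp add: prod.remove)
      moreover have "?w * ?t p = signof p * (?w * A $$ (i, p i)) * (\<Prod>i\<in>set C - {i}. A $$ (i, p i))"
        using calculation(2) by (simp add: mult_ac)
      ultimately show ?thesis by simp
    qed
    have "det (submatrix A (set C) (set C)) = 1" using princ Cn by (simp add: one_principled_def)
    then have "?w = (\<Sum>p | p permutes set C. ?w * ?t p)"
      unfolding det_submatrix_eq_sum[OF A Cn] by (simp add: sum_distrib_left[symmetric])
    also have "\<dots> = (\<Sum>p\<in>{id, ?c}. ?w * ?t p)"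
      using other c by (intro sum.mono_neutral_right) (auto simp: permutes_id finite_permutations)
    also have "\<dots> = ?w + ?w * (signof ?c * ?w)"
    proof -
      have "(\<Prod>i\<in>set C. A $$ (i, i)) = 1" using diag Cn by (intro prod.neutral) auto
      then show ?thesis
        using cneq cycle_weight_eq_prod_cycle_of_list[OF dist, of A] by simp
    qed
    (* The term of the identity cancels against the left-hand side. *)
    finally have "signof ?c * ?w ^ 2 = 0" by (simp add: power2_eq_square mult_ac)
    then have "?w ^ 2 = 0" by (cases ?c rule: sign_cases) simp_all
    then show ?case using red unfolding reduced_ring_def by blast
  qed
  then show ?thesis
    using one_principled_imp_one_diagonal[OF princ] A by (simp add: one_nullcyclic_def nullcyclic_def)
qed

section \<open>1-nullcyclic matrices are 1-principled\<close>

lemma nullcyclic_prod_permutation_eq_0: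
  assumes A: "nullcyclic n A" and S: "S \<subseteq> {..<n}" and p: "p permutes S" "p \<noteq> id"
  shows "(\<Prod>i\<in>S. A $$ (i, p i)) = 0"
proof -
  have fin: "finite S" using S by (rule finite_subset) simp
  have perm: "permutation p" using p fin permutation_permutes by blast
  obtain a where a: "p a \<noteq> a" using p(2) by fastforce
  let ?C = "support p a"
  have dist: "distinct ?C" by (rule cycle_of_permutation[OF perm])
  have aS: "a \<in> S" using a permutes_not_in[OF p(1)] by blast
  have CS: "set ?C \<subseteq> S"
    using aS permutes_in_image[OF permutes_funpow[OF p(1)]] by auto
  have "length ?C > 1" using least_power_gt_one[OF perm a] by simp
  then have "nontrivial_cycle n ?C"
    using dist CS S by (auto simp: nontrivial_cycle_def is_cycle_def)
  then have "cycle_weight A ?C = 0" using A by (auto simp: nullcyclic_def)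
  then have "(\<Prod>i\<in>set ?C. A $$ (i, cycle_of_list ?C i)) = 0"
    using cycle_weight_eq_prod_cycle_of_list[OF dist, of A] by simp
  also have "(\<Prod>i\<in>set ?C. A $$ (i, cycle_of_list ?C i)) = (\<Prod>i\<in>set ?C. A $$ (i, p i))"
    using cycle_restrict[OF perm] by (intro prod.cong) auto
  finally show ?thesis using prod.subset_diff[OF CS fin, of "\<lambda>i. A $$ (i, p i)"] by simp
qed

lemma one_nullcyclic_imp_one_principled:
  fixes A :: "'a::comm_ring_1 mat"
  assumes "one_nullcyclic n A"
  shows "one_principled n A"
proof -
  have A: "A \<in> carrier_mat n n" and null: "nullcyclic n A" and diag: "\<forall>i<n. A $$ (i, i) = 1"
    using assms by (auto simp: one_nullcyclic_def one_diagonal_def)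
  have "det (submatrix A S S) = 1" if S: "S \<subseteq> {..<n}" for S
  proof -
    have "finite S" using S by (rule finite_subset) simp
    then have "det (submatrix A S S) = (\<Sum>p\<in>{id}. signof p * (\<Prod>i\<in>S. A $$ (i, p i)))"
      unfolding det_submatrix_eq_sum[OF A S]
      using nullcyclic_prod_permutation_eq_0[OF null S]
      by (intro sum.mono_neutral_right) (auto simp: permutes_id finite_permutations)
    also have "(\<Prod>i\<in>S. A $$ (i, i)) = 1" using diag S by (intro prod.neutral) auto
    then have "(\<Sum>p\<in>{id}. signof p * (\<Prod>i\<in>S. A $$ (i, p i))) = 1" by simp
    finally show ?thesis .
  qed
  then show ?thesis using A by (simp add: one_principled_def)
qed

section \<open>Matrices whose entries are controlled by paths\<close>

definition path :: "nat \<Rightarrow> nat \<Rightarrow> nat \<Rightarrow> nat list \<Rightarrow> bool" where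
  "path n i j xs \<longleftrightarrow> xs \<noteq> [] \<and> distinct xs \<and> set xs \<subseteq> {..<n} \<and> hd xs = i \<and> last xs = j"

text \<open>The ideal generated by the weights of the paths from \<open>i\<close> to \<open>j\<close>, enlarged to its double
  annihilator.  In this form, membership is used and proved by moving a test element \<open>c\<close> around, and
  no linear combinations of path weights have to be written down.\<close>

definition path_closure :: "nat \<Rightarrow> 'a::comm_ring_1 mat \<Rightarrow> nat \<Rightarrow> nat \<Rightarrow> 'a set" where
  "path_closure n A i j =
     {x. \<forall>c. (\<forall>xs. path n i j xs \<longrightarrow> c * walk_weight A xs = 0) \<longrightarrow> c * x = 0}"

text \<open>The substitute for being unitriangular with respect to the reachability order of \<open>A\<close>.\<close>

definition path_unipotent :: "nat \<Rightarrow> 'a::comm_ring_1 mat \<Rightarrow> 'a mat \<Rightarrow> bool" where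
  "path_unipotent n A B \<longleftrightarrow>
     one_diagonal n B \<and> (\<forall>i<n. \<forall>j<n. B $$ (i, j) \<in> path_closure n A i j)"

lemma path_closureI:
  "(\<And>c. (\<And>xs. path n i j xs \<Longrightarrow> c * walk_weight A xs = 0) \<Longrightarrow> c * x = 0)
    \<Longrightarrow> x \<in> path_closure n A i j"
  by (auto simp: path_closure_def)

lemma path_closureD:
  "x \<in> path_closure n A i j \<Longrightarrow> (\<And>xs. path n i j xs \<Longrightarrow> c * walk_weight A xs = 0) \<Longrightarrow> c * x = 0"
  by (auto simp: path_closure_def)

text \<open>The one-vertex path has weight \<open>1\<close>, so the ideal for \<open>(i, i)\<close> is the whole ring; thus
  \<open>path_unipotent\<close> constrains diagonal entries only through \<open>one_diagonal\<close>.\<close>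

lemma path_closure_refl:
  assumes "i < n"
  shows "x \<in> path_closure n A i i"
proof (rule path_closureI)
  fix c assume "\<And>xs. path n i i xs \<Longrightarrow> c * walk_weight A xs = 0"
  from this[of "[i]"] show "c * x = 0" using assms by (simp add: path_def)
qed

lemma path_closure_edge:
  assumes "i < n" "j < n" "i \<noteq> j"
  shows "A $$ (i, j) \<in> path_closure n A i j"
proof (rule path_closureI)
  fix c assume "\<And>xs. path n i j xs \<Longrightarrow> c * walk_weight A xs = 0"
  from this[of "[i, j]"] show "c * A $$ (i, j) = 0" using assms by (simp add: path_def)
qed

lemma path_closure_0: "0 \<in> path_closure n A i j"
  by (auto simp: path_closure_def)

lemma path_closure_sum:
  "(\<And>k. k \<in> K \<Longrightarrow> f k \<in> path_closure n A i j) \<Longrightarrow> sum f K \<in> path_closure n A i j"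
  by (auto simp: path_closure_def sum_distrib_left intro!: sum.neutral)

text \<open>To annihilate a product, it is enough to annihilate the products of path weights: freeze
  one path as part of the test element and apply the definition to the other factor.\<close>

lemma path_closure_mult_annihilate:
  assumes x: "x \<in> path_closure n A i j" and y: "y \<in> path_closure n A j k"
    and c: "\<And>xs ys. path n i j xs \<Longrightarrow> path n j k ys \<Longrightarrow> c * (walk_weight A xs * walk_weight A ys) = 0"
  shows "c * (x * y) = 0"
proof -
  have "c * x * walk_weight A ys = 0" if "path n j k ys" for ys
    using path_closureD[OF x, of "c * walk_weight A ys"] c[OF _ that] by (simp add: mult_ac)
  from path_closureD[OF y this] show ?thesis by (simp add: mult_ac)
qed

lemma path_concat:
  assumes xs: "path n i j xs" and ys: "path n j k ys"
  defines "zs \<equiv> xs @ tl ys"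
  shows "walk_weight A zs = walk_weight A xs * walk_weight A ys"
    and "zs \<noteq> []" "set zs \<subseteq> {..<n}" "successively (\<noteq>) zs" "hd zs = i" "last zs = k"
    and "i = k \<Longrightarrow> i \<noteq> j \<Longrightarrow> \<not> distinct zs"
proof -
  obtain us where us: "xs = us @ [j]" using xs by (cases xs rule: rev_cases) (auto simp: path_def)
  obtain vs where vs: "ys = j # vs" using ys by (cases ys) (auto simp: path_def)
  have zs: "zs = us @ j # vs" by (simp add: zs_def us vs)
  show "walk_weight A zs = walk_weight A xs * walk_weight A ys"
    unfolding zs us vs by (rule walk_weight_append)
  have "successively (\<noteq>) xs" "successively (\<noteq>) ys"
    using xs ys by (auto simp: path_def intro: distinct_imp_successively_neq)
  then show "successively (\<noteq>) zs"
    unfolding zs us vs by (auto simp: successively_append_iff)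
  show "zs \<noteq> []" "set zs \<subseteq> {..<n}" "hd zs = i" "last zs = k"
    using xs ys by (auto simp: path_def zs us vs hd_append)
  show "\<not> distinct zs" if "i = k" "i \<noteq> j"
  proof -
    have "k \<in> set us" using xs that by (cases us) (auto simp: path_def us)
    moreover have "k \<in> set vs" using ys that by (auto simp: path_def vs split: if_splits)
    ultimately show ?thesis by (auto simp: zs)
  qed
qed

text \<open>The concatenation of two paths is a path, or it repeats a vertex and has weight \<open>0\<close>.\<close>

lemma path_closure_mult:
  assumes A: "nullcyclic n A" and x: "x \<in> path_closure n A i j" and y: "y \<in> path_closure n A j k"
  shows "x * y \<in> path_closure n A i k"
proof (rule path_closureI)
  fix c assume c: "\<And>xs. path n i k xs \<Longrightarrow> c * walk_weight A xs = 0"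
  show "c * (x * y) = 0"
  proof (rule path_closure_mult_annihilate[OF x y])
    fix xs ys assume p: "path n i j xs" "path n j k ys"
    note z = path_concat[OF p]
    show "c * (walk_weight A xs * walk_weight A ys) = 0"
    proof (cases "distinct (xs @ tl ys)")
      case True
      then have "path n i k (xs @ tl ys)" unfolding path_def using z(2-6) by blast
      then show ?thesis using c z(1) by metis
    next
      case False
      then show ?thesis using nullcyclic_walk_weight_eq_0[OF A z(3,4)] z(1)[of A] by simp
    qed
  qed
qed

text \<open>A path from \<open>i\<close> to \<open>j\<close> followed by one back to \<open>i\<close> repeats the vertex \<open>i\<close>.  This is the
  counterpart of antisymmetry for the reachability order.\<close>

lemma path_closure_mult_return:
  assumes A: "nullcyclic n A" and x: "x \<in> path_closure n A i j" and y: "y \<in> path_closure n A j i"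
    and "i \<noteq> j"
  shows "x * y = 0"
proof -
  have "1 * (x * y) = 0"
  proof (rule path_closure_mult_annihilate[OF x y])
    fix xs ys assume p: "path n i j xs" "path n j i ys"
    note z = path_concat[OF p]
    show "1 * (walk_weight A xs * walk_weight A ys) = 0"
      using nullcyclic_walk_weight_eq_0[OF A z(3,4) z(7)] z(1)[of A] \<open>i \<noteq> j\<close> by simp
  qed
  then show ?thesis by simp
qed

lemma path_unipotent_self:
  assumes "one_nullcyclic n A"
  shows "path_unipotent n A A"
  unfolding path_unipotent_def
proof (intro conjI allI impI)
  show "one_diagonal n A" using assms by (simp add: one_nullcyclic_def)
  fix i j assume "i < n" "j < n"
  then show "A $$ (i, j) \<in> path_closure n A i j"
    by (cases "i = j") (auto intro: path_closure_refl path_closure_edge)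
qed

lemma path_unipotent_one: "path_unipotent n A (1\<^sub>m n)"
  by (auto simp: path_unipotent_def one_diagonal_def path_closure_refl path_closure_0)

lemma index_mult_mat_sum:
  assumes "B \<in> carrier_mat n n" "C \<in> carrier_mat n n" "i < n" "j < n"
  shows "(B * C) $$ (i, j) = (\<Sum>k<n. B $$ (i, k) * C $$ (k, j))"
  using assms by (simp add: scalar_prod_def lessThan_atLeast0)

text \<open>On the diagonal of the product, a term that passes through another index \<open>k\<close> goes from
  \<open>i\<close> to \<open>k\<close> and back, so only the product of the diagonal entries survives.\<close>

lemma path_unipotent_mult:
  assumes A: "nullcyclic n A" and B: "path_unipotent n A B" and C: "path_unipotent n A C"
  shows "path_unipotent n A (B * C)"
proof -
  have Bn: "B \<in> carrier_mat n n" and Bd: "\<And>i. i < n \<Longrightarrow> B $$ (i, i) = 1"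
    and Bp: "\<And>i j. i < n \<Longrightarrow> j < n \<Longrightarrow> B $$ (i, j) \<in> path_closure n A i j"
    using B by (auto simp: path_unipotent_def one_diagonal_def)
  have Cn: "C \<in> carrier_mat n n" and Cd: "\<And>i. i < n \<Longrightarrow> C $$ (i, i) = 1"
    and Cp: "\<And>i j. i < n \<Longrightarrow> j < n \<Longrightarrow> C $$ (i, j) \<in> path_closure n A i j"
    using C by (auto simp: path_unipotent_def one_diagonal_def)
  have "(B * C) $$ (i, i) = 1" if i: "i < n" for i
  proof -
    have "(B * C) $$ (i, i) = (\<Sum>k<n. B $$ (i, k) * C $$ (k, i))"
      by (rule index_mult_mat_sum[OF Bn Cn i i])
    also have "\<dots> = (\<Sum>k\<in>{i}. B $$ (i, k) * C $$ (k, i))"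
      using i path_closure_mult_return[OF A Bp Cp]
      by (intro sum.mono_neutral_right) auto
    finally show ?thesis using Bd Cd i by simp
  qed
  moreover have "(B * C) $$ (i, j) \<in> path_closure n A i j" if "i < n" "j < n" for i j
    unfolding index_mult_mat_sum[OF Bn Cn that]
    using that by (intro path_closure_sum path_closure_mult[OF A Bp Cp]) auto
  ultimately show ?thesis
    using Bn Cn by (auto simp: path_unipotent_def one_diagonal_def)
qed

lemma path_unipotent_walk_weight:
  assumes A: "nullcyclic n A" and B: "path_unipotent n A B"
  shows "xs \<noteq> [] \<Longrightarrow> set xs \<subseteq> {..<n} \<Longrightarrow> walk_weight B xs \<in> path_closure n A (hd xs) (last xs)"
proof (induction xs rule: induct_list012)
  case (2 x)
  then show ?case by (auto intro: path_closure_refl)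
next
  case (3 x y zs)
  have "B $$ (x, y) \<in> path_closure n A x y" using B 3 by (auto simp: path_unipotent_def)
  then show ?case using 3 path_closure_mult[OF A] by auto
qed simp

lemma path_unipotent_imp_one_nullcyclic:
  assumes A: "nullcyclic n A" and B: "path_unipotent n A B"
  shows "one_nullcyclic n B"
proof -
  have "cycle_weight B C = 0" if "nontrivial_cycle n C" for C
  proof -
    have C: "C \<noteq> []" "distinct C" "set C \<subseteq> {..<n}" "length C > 1"
      using that by (auto simp: nontrivial_cycle_def is_cycle_def)
    have ends: "hd C < n" "last C < n" using C by (auto dest!: subsetD)
    have neq: "hd C \<noteq> last C"
      using C by (cases C) (auto split: if_splits)
    have "cycle_weight B C = walk_weight B C * B $$ (last C, hd C)"
      using C by (simp add: cycle_weight_eq_walk_weight walk_weight_snoc)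
    also have "\<dots> = 0"
    proof (rule path_closure_mult_return[OF A _ _ neq])
      show "walk_weight B C \<in> path_closure n A (hd C) (last C)"
        using path_unipotent_walk_weight[OF A B] C by blast
      show "B $$ (last C, hd C) \<in> path_closure n A (last C) (hd C)"
        using B ends by (auto simp: path_unipotent_def)
    qed
    finally show ?thesis .
  qed
  then show ?thesis
    using B by (auto simp: path_unipotent_def one_nullcyclic_def nullcyclic_def one_diagonal_def)
qed

text \<open>Row \<open>k\<close> of \<open>A * B = 1\<close> expresses \<open>B\<^bsub>k j\<^esub>\<close> through the entries \<open>B\<^bsub>l j\<^esub>\<close> with \<open>l \<noteq> k\<close>, with
  coefficients \<open>- A\<^bsub>k l\<^esub>\<close>.  Unrolling this recursion from \<open>k = i\<close> extends a path that starts at \<open>i\<close>; it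
  ends because a repeated vertex contributes \<open>0\<close> and a path has at most \<open>n\<close> vertices.  What remains
  are the weights of the paths that reach \<open>j\<close>.\<close>

lemma path_unipotent_right_inverse:
  fixes A :: "'a::comm_ring_1 mat"
  assumes A: "one_nullcyclic n A" and B: "B \<in> carrier_mat n n" and AB: "A * B = 1\<^sub>m n"
  shows "path_unipotent n A B"
proof -
  have An: "A \<in> carrier_mat n n" and null: "nullcyclic n A"
    and diag: "\<And>i. i < n \<Longrightarrow> A $$ (i, i) = 1"
    using A by (auto simp: one_nullcyclic_def one_diagonal_def)
  have rec: "B $$ (i, j) + (\<Sum>k\<in>{..<n} - {i}. A $$ (i, k) * B $$ (k, j)) = (if i = j then 1 else 0)"
    if "i < n" "j < n" for i j
  proof -
    have "(\<Sum>k<n. A $$ (i, k) * B $$ (k, j)) = (if i = j then 1 else 0)"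
      using index_mult_mat_sum[OF An B that] that by (simp add: AB)
    then show ?thesis using that diag by (simp add: sum.remove[of "{..<n}" i])
  qed
  have closure: "B $$ (i, j) \<in> path_closure n A i j" if ij: "i < n" "j < n" for i j
  proof (rule path_closureI)
    fix c assume c: "\<And>xs. path n i j xs \<Longrightarrow> c * walk_weight A xs = 0"
    (* Induction on the number of vertices that xs has not yet visited. *)
    have "c * walk_weight A xs * B $$ (k, j) = 0" if "path n i k xs" for k xs
      using that
    proof (induction "n - length xs" arbitrary: k xs rule: less_induct)
      case less
      have xs: "xs \<noteq> []" "distinct xs" "set xs \<subseteq> {..<n}" "hd xs = i" "last xs = k"
        using less.prems by (auto simp: path_def)
      have k: "k < n" using xs last_in_set by blast
      have ext: "c * walk_weight A xs * (A $$ (k, l) * B $$ (l, j)) = 0" if l: "l < n" "l \<noteq> k" for l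
      proof -
        have w: "c * walk_weight A xs * (A $$ (k, l) * B $$ (l, j))
            = c * walk_weight A (xs @ [l]) * B $$ (l, j)"
          using xs by (simp add: walk_weight_snoc mult.assoc)
        show ?thesis
        proof (cases "l \<in> set xs")
          case True
          have "walk_weight A (xs @ [l]) = 0"
          proof (rule nullcyclic_walk_weight_eq_0[OF null])
            show "successively (\<noteq>) (xs @ [l])"
              using xs l distinct_imp_successively_neq[of xs]
              by (auto simp: successively_append_iff)
          qed (use xs l True in auto)
          then show ?thesis using w by simp
        next
          case False
          have path: "path n i l (xs @ [l])" using xs l False by (auto simp: path_def)
          have "length (xs @ [l]) = card (set (xs @ [l]))"
            using path by (metis path_def distinct_card)
          also have "\<dots> \<le> n"
            using path card_mono[of "{..<n}" "set (xs @ [l])"] by (simp only: path_def) simp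
          finally have "c * walk_weight A (xs @ [l]) * B $$ (l, j) = 0"
            using less.hyps[OF _ path] by simp
          then show ?thesis using w by simp
        qed
      qed
      have "c * walk_weight A xs * B $$ (k, j)
          = c * walk_weight A xs * (if k = j then 1 else 0)
            - (\<Sum>l\<in>{..<n} - {k}. c * walk_weight A xs * (A $$ (k, l) * B $$ (l, j)))"
      proof -
        have "B $$ (k, j) = (if k = j then 1 else 0)
            - (\<Sum>l\<in>{..<n} - {k}. A $$ (k, l) * B $$ (l, j))"
          using rec[OF k ij(2)] by (simp only: eq_diff_eq)
        then show ?thesis by (simp only: right_diff_distrib sum_distrib_left)
      qed
      also have "\<dots> = c * walk_weight A xs * (if k = j then 1 else 0)"
        using ext by (simp add: sum.neutral)
      also have "\<dots> = 0" using c less.prems by auto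
      finally show ?case .
    qed
    from this[of i "[i]"] show "c * B $$ (i, j) = 0" using ij by (simp add: path_def)
  qed
  have "B $$ (i, i) = 1" if i: "i < n" for i
  proof -
    have "(\<Sum>k\<in>{..<n} - {i}. A $$ (i, k) * B $$ (k, i)) = 0"
      using i path_closure_mult_return[OF null path_closure_edge closure]
      by (intro sum.neutral) auto
    then show ?thesis using rec[OF i i] by simp
  qed
  then show ?thesis using B closure by (auto simp: path_unipotent_def one_diagonal_def)
qed

section \<open>Integer powers\<close>

theorem corollary4p10:
  fixes A :: "'a::comm_ring_1 mat" and n :: nat
  assumes "reduced_ring TYPE('a)"
    and "one_principled n A"
  shows "one_nullcyclic n A \<and> (\<forall>m::int. one_principled n (mat_int_pow n A m))"
proof (intro conjI allI)
  show nullA: "one_nullcyclic n A" using one_principled_imp_one_nullcyclic assms by blast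
  then have null: "nullcyclic n A" by (simp add: one_nullcyclic_def)
  let ?R = "ring_mat TYPE('a) n ()"
  interpret R: ring ?R by (rule ring_mat)
  have pow: "one_nullcyclic n (A [^]\<^bsub>?R\<^esub> k)" for k :: nat
  proof -
    have "path_unipotent n A (A [^]\<^bsub>?R\<^esub> k)"
    proof (induction k)
      case 0
      then show ?case by (simp add: ring_mat_simps path_unipotent_one)
    next
      case (Suc k)
      then show ?case
        by (simp add: ring_mat_simps path_unipotent_mult[OF null] path_unipotent_self[OF nullA])
    qed
    then show ?thesis by (rule path_unipotent_imp_one_nullcyclic[OF null])
  qed
  fix m :: int
  have "one_nullcyclic n (mat_int_pow n A m)"
  proof (cases "m < 0")
    case False
    then show ?thesis
      unfolding mat_int_pow_def int_pow_def2 using pow[of "nat m"] by (simp only: if_False)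
  next
    case True
    let ?P = "A [^]\<^bsub>?R\<^esub> nat (- m)"
    let ?Q = "inv\<^bsub>?R\<^esub> ?P"
    (* The inverse of P is controlled by the paths of P itself. *)
    have U: "?P \<in> Units ?R"
      using one_principled_unit[OF one_nullcyclic_imp_one_principled[OF pow]] .
    have "?Q \<in> carrier_mat n n" "?P * ?Q = 1\<^sub>m n"
      using R.Units_inv_closed[OF U] R.Units_r_inv[OF U] by (simp_all only: ring_mat_simps)
    then have "path_unipotent n ?P ?Q" by (rule path_unipotent_right_inverse[OF pow])
    then have "one_nullcyclic n ?Q"
      using pow path_unipotent_imp_one_nullcyclic by (auto simp: one_nullcyclic_def)
    then show ?thesis
      unfolding mat_int_pow_def int_pow_def2 using True by (simp only: if_True)
  qed
  then show "one_principled n (mat_int_pow n A m)" by (rule one_nullcyclic_imp_one_principled)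
qed

end
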